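(* Let $\phi$ be a pfo-formula such that $[\phi]_{ACO}$ is a normal form of the system $Y=(\mathrm{PFO},\to_{\{P\downarrow,S\downarrow,M\}})/\stackrel{*}{\leftrightarrow}_{ACO}$. Then $[\phi]_{\mathcal{T}}$ is a normal form of the system $Y'=(\mathrm{PFO},\to_{\{S\downarrow,M\}})/\stackrel{*}{\leftrightarrow}_{\mathcal{T}}$.
   Context: All formulas are relational first-order formulas; $\wedge,\vee$ are binary. A pfo-formula is a first-order formula with no negation; $\mathrm{PFO}$ is the class of all pfo-formulas; $\mathrm{free}(\psi)$ is the set of free variables of $\psi$. Rewriting rules (applicable to any subformula occurrence; $\oplus\in\{\wedge,\vee\}$, $Q\in\{\exists,\forall\}$): $A$: $F_1\oplus(F_2\oplus F_3)\to(F_1\oplus F_2)\oplus F_3$ and its converse; $C$: $F_1\oplus F_2\to F_2\oplus F_1$; $O$: $QxQyF\to QyQxF$; $P\!\downarrow$: $\exists x(F_1\wedge F_2)\to(\exists xF_1)\wedge F_2$ and $\forall x(F_1\vee F_2)\to(\forall xF_1)\vee F_2$ whenever $x\notin\mathrm{free}(F_2)$; $P\!\uparrow$: inverse of $P\!\downarrow$; $N$: $QxF\to QyF'$ when $y\notin\mathrm{free}(F)$ and $F'$ arises from $F$ by replacing each free occurrence of $x$ by $y$; $S\!\downarrow$: $\exists x(F_1\vee F_2)\to(\exists xF_1)\vee(\exists xF_2)$ and $\forall x(F_1\wedge F_2)\to(\forall xF_1)\wedge(\forall xF_2)$; $M$: $QxF\to F$ when $x\notin\mathrm{free}(F)$.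 $\mathcal{T}=\{A,C,O,P\!\downarrow,P\!\uparrow,N\}$. For a set $\mathcal{R}$ of rules, $\to_{\mathcal{R}}$ is the union of the $\to_R$; $\stackrel{*}{\leftrightarrow}_{\mathcal{R}}$ is the reflexive-transitive closure of $\to_{\mathcal{R}}$ together with its inverse; $[\phi]_{\mathcal{R}}$ is the $\stackrel{*}{\leftrightarrow}_{\mathcal{R}}$-class of $\phi$. A system is a pair $(D,\to)$; an element $d$ is a normal form (is in normal form) if there is no $d'$ with $d\to d'$. For an equivalence relation $\equiv$ on $D$, $(D,\to)/\equiv$ is the system whose elements are the $\equiv$-classes, with $C\to C'$ iff there exist $d\in C$, $d'\in C'$ with $d\to d'$.
   Formalization: Rule N is applied only when no replaced occurrence of x falls in the scope of a quantifier on y in F; without this proviso the claim fails, e.g. for ∃x∀y R(x,y), which N would turn into ∃y∀y R(y,y), where M applies. *)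

theory Defs
  imports Main
begin

type_synonym var = nat

datatype bop = And | Or

datatype quant = Exists | Forall

datatype 'r fo =
    Atom 'r "var list"
  | Neg "'r fo"
  | Bin bop "'r fo" "'r fo"
  | Qu quant var "'r fo"

fun free :: "'r fo \<Rightarrow> var set" where
  "free (Atom r xs) = set xs"
| "free (Neg F) = free F"
| "free (Bin b F G) = free F \<union> free G"
| "free (Qu q x F) = free F - {x}"

text \<open>The signature is given by its arity function.\<close>

fun over_signature :: "('r \<Rightarrow> nat) \<Rightarrow> 'r fo \<Rightarrow> bool" where
  "over_signature ar (Atom r xs) \<longleftrightarrow> length xs = ar r"
| "over_signature ar (Neg F) \<longleftrightarrow> over_signature ar F"
| "over_signature ar (Bin b F G) \<longleftrightarrow> over_signature ar F \<and> over_signature ar G"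
| "over_signature ar (Qu q x F) \<longleftrightarrow> over_signature ar F"

fun negation_free :: "'r fo \<Rightarrow> bool" where
  "negation_free (Atom r xs) \<longleftrightarrow> True"
| "negation_free (Neg F) \<longleftrightarrow> False"
| "negation_free (Bin b F G) \<longleftrightarrow> negation_free F \<and> negation_free G"
| "negation_free (Qu q x F) \<longleftrightarrow> negation_free F"

definition PFO :: "('r \<Rightarrow> nat) \<Rightarrow> 'r fo set" where
  "PFO ar = {F. over_signature ar F \<and> negation_free F}"

fun replace_free :: "var \<Rightarrow> var \<Rightarrow> 'r fo \<Rightarrow> 'r fo" where
  "replace_free x y (Atom r xs) = Atom r (map (\<lambda>z. if z = x then y else z) xs)"
| "replace_free x y (Neg F) = Neg (replace_free x y F)"
| "replace_free x y (Bin b F G) = Bin b (replace_free x y F) (replace_free x y G)"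
| "replace_free x y (Qu q z F) = (if z = x then Qu q z F else Qu q z (replace_free x y F))"

text \<open>No free occurrence of \<open>x\<close> lies in the scope of a quantifier on \<open>y\<close>.\<close>

fun substitutable :: "var \<Rightarrow> var \<Rightarrow> 'r fo \<Rightarrow> bool" where
  "substitutable x y (Atom r xs) \<longleftrightarrow> True"
| "substitutable x y (Neg F) \<longleftrightarrow> substitutable x y F"
| "substitutable x y (Bin b F G) \<longleftrightarrow> substitutable x y F \<and> substitutable x y G"
| "substitutable x y (Qu q z F) \<longleftrightarrow>
     x \<notin> free (Qu q z F) \<or> (z \<noteq> y \<and> substitutable x y F)"

datatype rule =
  Rule_A | Rule_C | Rule_O | Rule_Pdown | Rule_Pup | Rule_N | Rule_Sdown | Rule_M

text \<open>
  Rule N carries the usual proviso that the new occurrences of \<open>y\<close> are not captured by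
  quantifiers inside \<open>F\<close>. Without it, \<open>\<exists>x\<forall>y R(x,y)\<close> could be rewritten to
  \<open>\<exists>y\<forall>y R(y,y)\<close>, which is not logically equivalent to it.
\<close>

inductive root_step :: "rule \<Rightarrow> 'r fo \<Rightarrow> 'r fo \<Rightarrow> bool" where
  A_right: "root_step Rule_A (Bin b F1 (Bin b F2 F3)) (Bin b (Bin b F1 F2) F3)"
| A_left: "root_step Rule_A (Bin b (Bin b F1 F2) F3) (Bin b F1 (Bin b F2 F3))"
| C: "root_step Rule_C (Bin b F1 F2) (Bin b F2 F1)"
| O: "root_step Rule_O (Qu q x (Qu q y F)) (Qu q y (Qu q x F))"
| Pdown_Exists: "x \<notin> free F2 \<Longrightarrow>
    root_step Rule_Pdown (Qu Exists x (Bin And F1 F2)) (Bin And (Qu Exists x F1) F2)"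
| Pdown_Forall: "x \<notin> free F2 \<Longrightarrow>
    root_step Rule_Pdown (Qu Forall x (Bin Or F1 F2)) (Bin Or (Qu Forall x F1) F2)"
| Pup: "root_step Rule_Pdown F G \<Longrightarrow> root_step Rule_Pup G F"
| N: "y \<notin> free F \<Longrightarrow> substitutable x y F \<Longrightarrow>
    root_step Rule_N (Qu q x F) (Qu q y (replace_free x y F))"
| Sdown_Exists:
    "root_step Rule_Sdown (Qu Exists x (Bin Or F1 F2)) (Bin Or (Qu Exists x F1) (Qu Exists x F2))"
| Sdown_Forall:
    "root_step Rule_Sdown (Qu Forall x (Bin And F1 F2)) (Bin And (Qu Forall x F1) (Qu Forall x F2))"
| M: "x \<notin> free F \<Longrightarrow> root_step Rule_M (Qu q x F) F"

inductive rewrite_step :: "rule set \<Rightarrow> 'r fo \<Rightarrow> 'r fo \<Rightarrow> bool" for \<R> where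
  at_root: "R \<in> \<R> \<Longrightarrow> root_step R F G \<Longrightarrow> rewrite_step \<R> F G"
| Neg: "rewrite_step \<R> F G \<Longrightarrow> rewrite_step \<R> (Neg F) (Neg G)"
| Bin_left: "rewrite_step \<R> F G \<Longrightarrow> rewrite_step \<R> (Bin b F H) (Bin b G H)"
| Bin_right: "rewrite_step \<R> F G \<Longrightarrow> rewrite_step \<R> (Bin b H F) (Bin b H G)"
| Qu: "rewrite_step \<R> F G \<Longrightarrow> rewrite_step \<R> (Qu q x F) (Qu q x G)"

definition rules_ACO :: "rule set" where
  "rules_ACO = {Rule_A, Rule_C, Rule_O}"

definition rules_T :: "rule set" where
  "rules_T = {Rule_A, Rule_C, Rule_O, Rule_Pdown, Rule_Pup, Rule_N}"

definition convertible :: "('r \<Rightarrow> nat) \<Rightarrow> rule set \<Rightarrow> ('r fo \<times> 'r fo) set" where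
  "convertible ar \<R> = {(F, G). F \<in> PFO ar \<and> G \<in> PFO ar \<and> equivclp (rewrite_step \<R>) F G}"

definition conv_class :: "('r \<Rightarrow> nat) \<Rightarrow> rule set \<Rightarrow> 'r fo \<Rightarrow> 'r fo set" where
  "conv_class ar \<R> F = convertible ar \<R> `` {F}"

lemma equiv_convertible: "equiv (PFO ar) (convertible ar \<R>)"
  by (intro equivI refl_onI symI transI)
    (auto simp: convertible_def intro: equivclp_sym equivclp_trans)

type_synonym 'a system = "'a set \<times> ('a \<Rightarrow> 'a \<Rightarrow> bool)"

definition normal_form :: "'a system \<Rightarrow> 'a \<Rightarrow> bool" where
  "normal_form S d \<longleftrightarrow> d \<in> fst S \<and> \<not> (\<exists>d' \<in> fst S. snd S d d')"

definition quotient_system :: "'a system \<Rightarrow> ('a \<times> 'a) set \<Rightarrow> 'a set system" where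
  "quotient_system S E = (fst S // E, \<lambda>K K'. \<exists>d \<in> K. \<exists>d' \<in> K'. snd S d d')"

definition system_Y :: "('r \<Rightarrow> nat) \<Rightarrow> 'r fo set system" where
  "system_Y ar = quotient_system
     (PFO ar, rewrite_step {Rule_Pdown, Rule_Sdown, Rule_M}) (convertible ar rules_ACO)"

definition system_Y' :: "('r \<Rightarrow> nat) \<Rightarrow> 'r fo set system" where
  "system_Y' ar = quotient_system
     (PFO ar, rewrite_step {Rule_Sdown, Rule_M}) (convertible ar rules_T)"

end

theory Submission
  imports Defs "HOL-Library.Multiset"
begin

text \<open>
  A formula splits into maximal blocks built from \<open>\<exists>, \<and>\<close> only or from \<open>\<forall>, \<or>\<close> only; the leaves of
  a block are atoms or dual blocks. The rules in \<open>\<T>\<close> rearrange blocks internally, but they preserve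
  which free variables the leaves of a block have, and which leaves are connected through
  variables quantified in the block. Call a formula bad if it has a vacuous quantifier, or a
  quantifier whose variable occurs in exactly one leaf of its block, this leaf being a dual block with
  at least two connected components. Badness is thus invariant under \<open>\<T>\<close>, and every redex of
  \<open>S\<down>\<close> or \<open>M\<close> makes a formula bad. Conversely, in a bad formula without vacuous quantifiers on which
  \<open>P\<down>\<close> is exhausted modulo \<open>ACO\<close>, the disconnected leaf has its connective at the root and the
  quantifier can be moved right above it, which gives a redex of \<open>S\<down>\<close>.
\<close>

section \<open>Merging the sets that contain a quantified variable\<close>

fun conn :: "quant \<Rightarrow> bop" where
  "conn Exists = And"
| "conn Forall = Or"

fun dual :: "bop \<Rightarrow> bop" where
  "dual And = Or"
| "dual Or = And"

lemma dual_eq_iff: "dual b = c \<longleftrightarrow> c \<noteq> b"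
  by (cases b; cases c) auto

text \<open>The effect of a quantifier on \<open>x\<close> inside its own block: the components that
  contain \<open>x\<close> become one, and \<open>x\<close> stops being free. The first branch keeps
  a vacuous quantifier from creating an empty component. Multisets are needed because different
  components may have the same free variables.\<close>

definition merge :: "'a \<Rightarrow> 'a set multiset \<Rightarrow> 'a set multiset" where
  "merge x M = (if \<forall>S\<in>#M. x \<notin> S then M
     else add_mset (\<Union> {S. S \<in># M \<and> x \<in> S} - {x}) {#S \<in># M. x \<notin> S#})"

lemma merge_avoid: "\<forall>S\<in>#M. x \<notin> S \<Longrightarrow> merge x M = M"
  by (simp add: merge_def)

lemma merge_occurs:
  assumes "\<exists>S\<in>#M. x \<in> S"
  shows "merge x M = add_mset (\<Union> {S. S \<in># M \<and> x \<in> S} - {x}) {#S \<in># M. x \<notin> S#}"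
  unfolding merge_def by (rule if_not_P) (use assms in blast)

lemma merge_union:
  assumes "\<forall>S\<in>#N. x \<notin> S"
  shows "merge x (M + N) = merge x M + N"
proof (cases "\<forall>S\<in>#M. x \<notin> S")
  case True
  then show ?thesis
    using assms by (simp add: merge_avoid ball_Un)
next
  case False
  have "{S. S \<in># M + N \<and> x \<in> S} = {S. S \<in># M \<and> x \<in> S}"
    using assms by auto
  moreover have "{#S \<in># M + N. x \<notin> S#} = {#S \<in># M. x \<notin> S#} + N"
    using assms by (simp add: filter_mset_eq_conv)
  moreover have "\<not> (\<forall>S\<in>#M + N. x \<notin> S)"
    using False by auto
  ultimately show ?thesis
    using False by (simp only: merge_def if_False add_mset_add_single[symmetric]) simp
qed

lemma Union_merge: "\<Union> (set_mset (merge x M)) = \<Union> (set_mset M) - {x}"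
  by (auto simp: merge_def)

lemma merge_commute_avoid:
  assumes "\<forall>S\<in>#M. x \<notin> S"
  shows "merge x (merge y M) = merge y (merge x M)"
proof -
  have "\<forall>S\<in>#merge y M. x \<notin> S"
    using assms Union_merge[of y M] by blast
  then show ?thesis
    using assms by (simp add: merge_avoid)
qed

text \<open>A set with both variables links the two families into one; otherwise they merge
  independently. Either right-hand side is symmetric in \<open>x\<close> and \<open>y\<close> up to
  the order of insertion, which gives \<open>merge_commute\<close> and hence invariance under rule
  O.\<close>

lemma merge_merge:
  assumes "x \<noteq> y" "\<exists>S\<in>#M. x \<in> S" "\<exists>S\<in>#M. y \<in> S"
  shows "merge x (merge y M) =
    (if \<exists>S\<in>#M. x \<in> S \<and> y \<in> S then
       add_mset (\<Union> {S. S \<in># M \<and> (x \<in> S \<or> y \<in> S)} - {x, y}) {#S \<in># M. x \<notin> S \<and> y \<notin> S#}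
     else add_mset (\<Union> {S. S \<in># M \<and> x \<in> S} - {x})
       (add_mset (\<Union> {S. S \<in># M \<and> y \<in> S} - {y}) {#S \<in># M. x \<notin> S \<and> y \<notin> S#}))"
proof -
  let ?U = "\<Union> {S. S \<in># M \<and> y \<in> S} - {y}"
  let ?M = "{#S \<in># M. y \<notin> S#}"
  have m: "merge y M = add_mset ?U ?M"
    by (rule merge_occurs[OF assms(3)])
  show ?thesis
  proof (cases "\<exists>S\<in>#M. x \<in> S \<and> y \<in> S")
    case True
    then have xU: "x \<in> ?U"
      using assms(1) by auto
    have "\<Union> {S. S \<in># merge y M \<and> x \<in> S} - {x} = \<Union> {S. S \<in># M \<and> (x \<in> S \<or> y \<in> S)} - {x, y}"
      unfolding m using xU by auto
    moreover have "{#S \<in># merge y M. x \<notin> S#} = {#S \<in># M. x \<notin> S \<and> y \<notin> S#}"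
      unfolding m using xU by (simp add: filter_filter_mset conj_commute)
    moreover have "\<exists>S\<in>#merge y M. x \<in> S"
      unfolding m using xU by auto
    ultimately show ?thesis
      using True by (simp add: merge_occurs)
  next
    case False
    then have xU: "x \<notin> ?U"
      by auto
    have "{S. S \<in># merge y M \<and> x \<in> S} = {S. S \<in># M \<and> x \<in> S}"
      unfolding m using xU False by auto
    moreover have "{#S \<in># merge y M. x \<notin> S#} = add_mset ?U {#S \<in># M. x \<notin> S \<and> y \<notin> S#}"
      unfolding m using xU by (simp add: filter_filter_mset conj_commute)
    moreover have "\<exists>S\<in>#merge y M. x \<in> S"
      unfolding m using assms(2) False by auto
    ultimately show ?thesis
      using False by (simp add: merge_occurs)
  qed
qed

lemma merge_commute: "merge x (merge y M) = merge y (merge x M)"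
proof -
  consider "x = y" | "\<forall>S\<in>#M. x \<notin> S" | "\<forall>S\<in>#M. y \<notin> S"
    | "x \<noteq> y" "\<exists>S\<in>#M. x \<in> S" "\<exists>S\<in>#M. y \<in> S"
    by blast
  then show ?thesis
  proof cases
    case 2
    then show ?thesis
      by (rule merge_commute_avoid)
  next
    case 3
    then show ?thesis
      by (rule merge_commute_avoid[symmetric])
  next
    case 4
    have sym: "{S. S \<in># M \<and> (y \<in> S \<or> x \<in> S)} = {S. S \<in># M \<and> (x \<in> S \<or> y \<in> S)}"
      "{#S \<in># M. y \<notin> S \<and> x \<notin> S#} = {#S \<in># M. x \<notin> S \<and> y \<notin> S#}"
      "(\<exists>S\<in>#M. y \<in> S \<and> x \<in> S) \<longleftrightarrow> (\<exists>S\<in>#M. x \<in> S \<and> y \<in> S)"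
      "{y, x} = {x, y}"
      by (auto intro: filter_mset_cong)
    show ?thesis
      unfolding merge_merge[OF 4] merge_merge[OF 4(1)[symmetric] 4(3,2)] sym
      by (simp only: add_mset_commute)
  qed simp
qed

text \<open>Serves renaming in two ways: \<open>f\<close> fixes the variable of an inner quantifier,
  or \<open>f\<close> sends the renamed variable to its new name.\<close>

lemma merge_image:
  assumes "inj_on f (insert x (\<Union> (set_mset M)))"
  shows "merge (f x) (image_mset ((`) f) M) = image_mset ((`) f) (merge x M)"
proof -
  have mem: "f x \<in> f ` S \<longleftrightarrow> x \<in> S" if "S \<in># M" for S
    using assms that by (auto simp: inj_on_def)
  have filter: "{#S \<in># image_mset ((`) f) M. f x \<notin> S#} = image_mset ((`) f) {#S \<in># M. x \<notin> S#}"
    unfolding filter_mset_image_mset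
    by (rule arg_cong[where f = "image_mset ((`) f)"], rule filter_mset_cong) (auto simp: mem)
  have "{S. S \<in># image_mset ((`) f) M \<and> f x \<in> S} = (`) f ` {S. S \<in># M \<and> x \<in> S}"
    using mem by auto
  then have "\<Union> {S. S \<in># image_mset ((`) f) M \<and> f x \<in> S} - {f x}
      = f ` \<Union> {S. S \<in># M \<and> x \<in> S} - {f x}"
    by (simp add: image_Union)
  also have "\<dots> = f ` (\<Union> {S. S \<in># M \<and> x \<in> S} - {x})"
    using assms by (subst inj_on_image_set_diff[of f "insert x (\<Union> (set_mset M))"]) auto
  finally show ?thesis
    using mem filter by (simp add: merge_def)
qed

lemma merge_eq_empty_iff [simp]: "merge x M = {#} \<longleftrightarrow> M = {#}"
  by (auto simp: merge_def)

section \<open>Components and leaves of blocks, and badness\<close>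

text \<open>
  The free variables of the connected components of the \<open>b\<close>-block at the root: two leaves are
  connected if they share a variable quantified in the block. A formula that is not a \<open>b\<close>-block
  is a single leaf.
\<close>

fun components :: "bop \<Rightarrow> 'r fo \<Rightarrow> var set multiset" where
  "components b (Bin c F G) =
     (if c = b then components b F + components b G else {#free F \<union> free G#})"
| "components b (Qu q x F) =
     (if conn q = b then merge x (components b F) else {#free F - {x}#})"
| "components b F = {#free F#}"

definition disconnected :: "bop \<Rightarrow> 'r fo \<Rightarrow> bool" where
  "disconnected b F \<longleftrightarrow> 2 \<le> size (components b F)"

text \<open>
  Each leaf of the \<open>b\<close>-block at the root is recorded by its variables that are free in the whole
  block and by whether it is a disconnected dual block.
\<close>

fun leaves :: "bop \<Rightarrow> 'r fo \<Rightarrow> (var set \<times> bool) multiset" where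
  "leaves b (Bin c F G) =
     (if c = b then leaves b F + leaves b G
      else {#(free F \<union> free G, disconnected (dual b) (Bin c F G))#})"
| "leaves b (Qu q x F) =
     (if conn q = b then image_mset (map_prod (\<lambda>S. S - {x}) id) (leaves b F)
      else {#(free F - {x}, disconnected (dual b) (Qu q x F))#})"
| "leaves b F = {#(free F, False)#}"

text \<open>The flags are collected in a multiset so that two leaves containing \<open>x\<close>
  count twice, even if both are disconnected dual blocks.\<close>

definition splittable :: "var \<Rightarrow> (var set \<times> bool) multiset \<Rightarrow> bool" where
  "splittable x L \<longleftrightarrow> {#snd p. p \<in># {#p \<in># L. x \<in> fst p#}#} = {#True#}"

fun bad :: "'r fo \<Rightarrow> bool" where
  "bad (Atom r xs) \<longleftrightarrow> False"
| "bad (Neg F) \<longleftrightarrow> bad F"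
| "bad (Bin b F G) \<longleftrightarrow> bad F \<or> bad G"
| "bad (Qu q x F) \<longleftrightarrow> bad F \<or> x \<notin> free F \<or> splittable x (leaves (conn q) F)"

lemma Union_components: "\<Union> (set_mset (components b F)) = free F"
  by (induction b F rule: components.induct) (auto simp: Union_merge)

lemma components_subset_free: "S \<in># components b F \<Longrightarrow> S \<subseteq> free F"
  using Union_components by blast

lemma components_nonempty [simp]: "components b F \<noteq> {#}"
  by (induction b F rule: components.induct) auto

lemma Union_leaves: "\<Union> (fst ` set_mset (leaves b F)) = free F"
  by (induction b F rule: leaves.induct) (auto simp: Un_commute)

lemma leaves_subset_free: "p \<in># leaves b F \<Longrightarrow> fst p \<subseteq> free F"
  using Union_leaves by blast

lemma splittable_image:
  assumes "\<And>p. p \<in># L \<Longrightarrow> z \<in> f (fst p) \<longleftrightarrow> x \<in> fst p"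
  shows "splittable z (image_mset (map_prod f id) L) \<longleftrightarrow> splittable x L"
proof -
  have "{#p \<in># L. z \<in> f (fst p)#} = {#p \<in># L. x \<in> fst p#}"
    by (rule filter_mset_cong) (simp_all add: assms)
  then show ?thesis
    by (simp add: splittable_def filter_mset_image_mset image_mset.compositionality comp_def)
qed

lemma filter_mset_eq_empty: "\<forall>p\<in>#N. \<not> P p \<Longrightarrow> {#p \<in># N. P p#} = {#}"
  by simp

lemma splittable_union_avoid:
  assumes "\<forall>p\<in>#N. x \<notin> fst p"
  shows "splittable x (L + N) \<longleftrightarrow> splittable x L"
  using filter_mset_eq_empty[OF assms] by (simp only: splittable_def filter_union_mset) simp

text \<open>Badness alone does not pass through contexts: under a quantifier it depends on
  \<open>free\<close> and \<open>leaves\<close>, the flags of leaves depend on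
  \<open>components\<close> of the dual block, and these again on \<open>free\<close>. Both
  connectives are included since a context may extend a block of either kind.\<close>

definition same_shape :: "'r fo \<Rightarrow> 'r fo \<Rightarrow> bool" where
  "same_shape F G \<longleftrightarrow> free F = free G \<and> (\<forall>b. components b F = components b G)
     \<and> (\<forall>b. leaves b F = leaves b G) \<and> (bad F \<longleftrightarrow> bad G)"

section \<open>The effect of renaming a free variable\<close>

lemma replace_free_id: "x \<notin> free F \<Longrightarrow> replace_free x y F = F"
  by (induction F) (auto intro: map_idI)

definition rename :: "var \<Rightarrow> var \<Rightarrow> var \<Rightarrow> var" where
  "rename x y = id(x := y)"

lemma rename_simps [simp]:
  "rename x y x = y"
  "z \<noteq> x \<Longrightarrow> rename x y z = z"
  by (simp_all add: rename_def)

lemma mem_rename_image: "w \<in> rename x y ` S \<longleftrightarrow> (x \<in> S \<and> w = y) \<or> (w \<in> S \<and> w \<noteq> x)"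
  by (auto simp: rename_def image_iff)

lemma rename_image_Diff:
  "z \<noteq> x \<Longrightarrow> z \<noteq> y \<Longrightarrow> rename x y ` S - {z} = rename x y ` (S - {z})"
  by (rule set_eqI) (simp only: Diff_iff mem_rename_image singleton_iff, blast)

text \<open>For the branch of \<open>substitutable\<close> where \<open>x\<close> is not free. There
  a quantifier may bind \<open>y\<close>, so the induction hypothesis is out of reach, but neither
  the formula nor its variable sets change.\<close>

lemma substitution_identity:
  assumes "x \<notin> free F"
  shows "rename x y ` free F = free F"
    "image_mset ((`) (rename x y)) (components b F) = components b F"
    "image_mset (map_prod ((`) (rename x y)) id) (leaves b F) = leaves b F"
proof -
  have r: "rename x y ` S = S" if "S \<subseteq> free F" for S
    using assms that by (auto simp: mem_rename_image del: imageE image_eqI)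
  show "rename x y ` free F = free F"
    by (simp add: r)
  show "image_mset ((`) (rename x y)) (components b F) = components b F"
    by (rule multiset.map_ident_strong) (simp add: r components_subset_free)
  show "image_mset (map_prod ((`) (rename x y)) id) (leaves b F) = leaves b F"
    by (rule multiset.map_ident_strong) (auto simp: r dest: leaves_subset_free)
qed

lemma free_replace_free:
  assumes "y \<notin> free F" "substitutable x y F"
  shows "free (replace_free x y F) = rename x y ` free F"
  using assms
proof (induction F)
  case (Qu q z F)
  show ?case
  proof (cases "x \<in> free (Qu q z F)")
    case True
    then have z: "z \<noteq> x" "z \<noteq> y" "y \<notin> free F" "substitutable x y F"
      using Qu.prems by auto
    then show ?thesis
      using Qu.IH by (simp add: rename_image_Diff)
  next
    case False
    then show ?thesis
      by (simp only: replace_free_id[OF False] substitution_identity[OF False])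
  qed
next
  case (Atom r xs)
  show ?case
    by (simp add: rename_def fun_upd_def)
qed (simp_all add: image_Un)

lemma components_replace_free:
  assumes "y \<notin> free F" "substitutable x y F"
  shows "components b (replace_free x y F) = image_mset ((`) (rename x y)) (components b F)"
  using assms
proof (induction F)
  case (Qu q z F)
  show ?case
  proof (cases "x \<in> free (Qu q z F)")
    case True
    then have z: "z \<noteq> x" "z \<noteq> y" "y \<notin> free F" "substitutable x y F"
      using Qu.prems by auto
    \<comment> \<open>The image of \<open>x\<close> could only collide with \<open>y\<close>, which
      is neither free in \<open>F\<close> nor equal to \<open>z\<close>.\<close>
    have "inj_on (rename x y) (insert z (\<Union> (set_mset (components b F))))"
      using z by (auto simp: Union_components inj_on_def rename_def)
    from merge_image[OF this] have
      "merge z (image_mset ((`) (rename x y)) (components b F))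
         = image_mset ((`) (rename x y)) (merge z (components b F))"
      using z by simp
    then show ?thesis
      using z Qu.IH by (simp add: free_replace_free rename_image_Diff)
  next
    case False
    then show ?thesis
      by (simp only: replace_free_id[OF False] substitution_identity[OF False])
  qed
next
  case (Atom r xs)
  show ?case
    using free_replace_free[OF Atom] by simp
qed (auto simp: free_replace_free image_Un)

lemma disconnected_replace_free:
  "y \<notin> free F \<Longrightarrow> substitutable x y F \<Longrightarrow>
     disconnected b (replace_free x y F) \<longleftrightarrow> disconnected b F"
  by (simp add: disconnected_def components_replace_free)

text \<open>The flags survive because \<open>disconnected\<close> counts components, and taking
  images keeps the size of a multiset.\<close>

lemma leaves_replace_free:
  assumes "y \<notin> free F" "substitutable x y F"
  shows "leaves b (replace_free x y F) = image_mset (map_prod ((`) (rename x y)) id) (leaves b F)"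
  using assms
proof (induction F)
  case (Bin c F G)
  show ?case
    using Bin disconnected_replace_free[of y "Bin c F G" x "dual b"]
    by (simp add: free_replace_free image_Un)
next
  case (Qu q z F)
  show ?case
  proof (cases "x \<in> free (Qu q z F)")
    case True
    then have z: "z \<noteq> x" "z \<noteq> y" "y \<notin> free F" "substitutable x y F"
      using Qu.prems by auto
    show ?thesis
      using z Qu.IH disconnected_replace_free[OF Qu.prems, of "dual b"]
      by (simp add: free_replace_free image_mset.compositionality comp_def map_prod_def
            split_beta rename_image_Diff)
  next
    case False
    then show ?thesis
      by (simp only: replace_free_id[OF False] substitution_identity[OF False])
  qed
next
  case (Atom r xs)
  show ?case
    using free_replace_free[OF Atom] by simp
qed (auto simp: free_replace_free)

lemma bad_replace_free:
  assumes "y \<notin> free F" "substitutable x y F"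
  shows "bad (replace_free x y F) \<longleftrightarrow> bad F"
  using assms
proof (induction F)
  case (Qu q z F)
  show ?case
  proof (cases "x \<in> free (Qu q z F)")
    case True
    then have z: "z \<noteq> x" "z \<noteq> y" "y \<notin> free F" "substitutable x y F"
      using Qu.prems by auto
    then have *: "z \<in> rename x y ` S \<longleftrightarrow> z \<in> S" for S
      by (auto simp: mem_rename_image del: imageE image_eqI)
    have "splittable z (leaves (conn q) (replace_free x y F)) \<longleftrightarrow> splittable z (leaves (conn q) F)"
      unfolding leaves_replace_free[OF z(3,4)] by (rule splittable_image) (rule *)
    with z Qu.IH show ?thesis
      by (simp add: free_replace_free *)
  next
    case False
    then show ?thesis
      by (simp only: replace_free_id[OF False])
  qed
qed auto

section \<open>Invariance of the shape under the rules in \<open>rules_T\<close>\<close>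

lemma same_shape_Neg: "same_shape F G \<Longrightarrow> same_shape (Neg F) (Neg G)"
  by (simp add: same_shape_def)

lemma same_shape_Bin:
  "same_shape F F' \<Longrightarrow> same_shape G G' \<Longrightarrow> same_shape (Bin b F G) (Bin b F' G')"
  by (simp add: same_shape_def disconnected_def)

lemma same_shape_Qu: "same_shape F F' \<Longrightarrow> same_shape (Qu q x F) (Qu q x F')"
  by (simp add: same_shape_def disconnected_def)

lemma same_shape_O: "same_shape (Qu q x (Qu q y F)) (Qu q y (Qu q x F))"
proof (cases "x = y")
  case False
  have "{#map_prod (\<lambda>S. S - {x}) id p. p \<in># {#map_prod (\<lambda>S. S - {y}) id p. p \<in># leaves b F#}#}
      = {#map_prod (\<lambda>S. S - {y}) id p. p \<in># {#map_prod (\<lambda>S. S - {x}) id p. p \<in># leaves b F#}#}"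
    for b
    by (auto simp: image_mset.compositionality intro!: image_mset_cong)
  moreover have "free F - {y} - {x} = free F - {x} - {y}"
    by auto
  ultimately show ?thesis
    using False by (auto simp: same_shape_def disconnected_def merge_commute splittable_image)
qed (simp add: same_shape_def)

text \<open>The block stays the same, and no component or leaf of \<open>G\<close> contains
  \<open>x\<close>, so the quantifier neither merges nor changes anything there. Rule
  \<open>Rule_Pup\<close> follows by symmetry.\<close>

lemma same_shape_P:
  assumes "x \<notin> free G"
  shows "same_shape (Qu q x (Bin (conn q) F G)) (Bin (conn q) (Qu q x F) G)"
proof -
  have C: "\<forall>S\<in>#components b G. x \<notin> S" and L: "p \<in># leaves b G \<Longrightarrow> x \<notin> fst p" for b p
    using assms components_subset_free leaves_subset_free by blast+
  have "{#map_prod (\<lambda>S. S - {x}) id p. p \<in># leaves b G#} = leaves b G" for b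
    by (rule multiset.map_ident_strong) (auto dest!: L)
  moreover have "free F \<union> free G - {x} = (free F - {x}) \<union> free G"
    using assms by auto
  ultimately show ?thesis
    using assms
    by (auto simp: same_shape_def disconnected_def merge_union C splittable_union_avoid L)
qed

lemma same_shape_N:
  assumes "y \<notin> free F" "substitutable x y F"
  shows "same_shape (Qu q x F) (Qu q y (replace_free x y F))"
proof -
  let ?r = "rename x y"
  have inj: "inj_on ?r (insert x (\<Union> (set_mset (components b F))))" for b
    using assms by (auto simp: Union_components inj_on_def rename_def)
  have diff: "?r ` S - {y} = S - {x}" if "S \<subseteq> free F" for S
    using that assms by (auto simp: mem_rename_image del: imageE image_eqI)
  have mem: "y \<in> ?r ` S \<longleftrightarrow> x \<in> S" if "S \<subseteq> free F" for S
    using that assms by (auto simp: mem_rename_image del: imageE image_eqI)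
  have "merge y (image_mset ((`) ?r) (components b F)) = merge x (components b F)" for b
  proof -
    \<comment> \<open>After the merge \<open>x\<close> is gone, so renaming \<open>x\<close> fixes
      every remaining set.\<close>
    have "image_mset ((`) ?r) (merge x (components b F)) = merge x (components b F)"
    proof (rule multiset.map_ident_strong)
      fix S assume "S \<in># merge x (components b F)"
      then have "x \<notin> S"
        using Union_merge[of x "components b F"] by blast
      then show "?r ` S = S"
        by (auto simp: mem_rename_image del: imageE image_eqI)
    qed
    then show ?thesis
      using merge_image[OF inj, of b] by simp
  qed
  moreover have "{#map_prod (\<lambda>S. S - {y}) id p. p \<in># image_mset (map_prod ((`) ?r) id) (leaves b F)#}
      = image_mset (map_prod (\<lambda>S. S - {x}) id) (leaves b F)" for b
    unfolding image_mset.compositionality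
    by (rule image_mset_cong) (auto simp: diff dest!: leaves_subset_free)
  moreover have "splittable y (image_mset (map_prod ((`) ?r) id) (leaves b F))
      \<longleftrightarrow> splittable x (leaves b F)" for b
    by (rule splittable_image) (rule mem[OF leaves_subset_free])
  ultimately show ?thesis
    using assms
    by (simp add: same_shape_def disconnected_def components_replace_free free_replace_free
        leaves_replace_free bad_replace_free diff mem)
qed

lemma root_step_Pdown_iff:
  "root_step Rule_Pdown F G \<longleftrightarrow>
     (\<exists>q x F1 F2. F = Qu q x (Bin (conn q) F1 F2) \<and> G = Bin (conn q) (Qu q x F1) F2 \<and> x \<notin> free F2)"
proof
  assume "root_step Rule_Pdown F G"
  then show "\<exists>q x F1 F2. F = Qu q x (Bin (conn q) F1 F2) \<and> G = Bin (conn q) (Qu q x F1) F2 \<and> x \<notin> free F2"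
    by cases (force intro: exI[of _ Exists] exI[of _ Forall])+
next
  assume "\<exists>q x F1 F2. F = Qu q x (Bin (conn q) F1 F2) \<and> G = Bin (conn q) (Qu q x F1) F2 \<and> x \<notin> free F2"
  then obtain q x F1 F2 where "F = Qu q x (Bin (conn q) F1 F2)" "G = Bin (conn q) (Qu q x F1) F2" "x \<notin> free F2"
    by blast
  then show "root_step Rule_Pdown F G"
    by (cases q) (auto intro: Pdown_Exists Pdown_Forall)
qed

lemma same_shape_sym: "same_shape F G \<Longrightarrow> same_shape G F"
  by (simp add: same_shape_def)

lemma same_shape_root_step:
  assumes "root_step R F G" "R \<in> rules_T"
  shows "same_shape F G"
  using assms
proof (induction rule: root_step.induct)
  case (A_right b F1 F2 F3)
  then show ?case
    by (auto simp: same_shape_def disconnected_def add.assoc Un_assoc)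
next
  case (A_left b F1 F2 F3)
  then show ?case
    by (auto simp: same_shape_def disconnected_def add.assoc Un_assoc)
next
  case (C b F1 F2)
  then show ?case
    by (auto simp: same_shape_def disconnected_def add.commute Un_commute)
next
  case (Pup F G)
  then show ?case
    by (auto simp: rules_T_def intro: same_shape_sym)
next
  case (Pdown_Exists x F2 F1)
  then show ?case
    using same_shape_P[of x F2 Exists F1] by simp
next
  case (Pdown_Forall x F2 F1)
  then show ?case
    using same_shape_P[of x F2 Forall F1] by simp
qed (auto simp: rules_T_def intro: same_shape_O same_shape_N)

lemma same_shape_refl: "same_shape F F"
  by (simp add: same_shape_def)

lemma same_shape_rewrite_step:
  "rewrite_step rules_T F G \<Longrightarrow> same_shape F G"
  by (induction rule: rewrite_step.induct)
    (auto intro: same_shape_root_step same_shape_Neg same_shape_Bin same_shape_Qu same_shape_refl)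

lemma bad_convertible:
  assumes "equivclp (rewrite_step rules_T) F G"
  shows "bad F \<longleftrightarrow> bad G"
  using assms
  by (induction rule: equivclp_induct) (auto dest!: same_shape_rewrite_step simp: same_shape_def)

section \<open>Redexes of \<open>Rule_Sdown\<close> and \<open>Rule_M\<close> are bad\<close>

lemma bad_root_step:
  assumes "root_step R F G" "R \<in> {Rule_Sdown, Rule_M}"
  shows "bad F"
proof -
  \<comment> \<open>The body is the only leaf below the quantifier, and each operand contributes at
    least one component to it. If \<open>x\<close> is not free in the body, the quantifier is
    vacuous, as in a redex of \<open>Rule_M\<close>.\<close>
  have *: "bad (Qu q x (Bin b F1 F2))" if "b \<noteq> conn q" for q x b and F1 F2 :: "'r fo"
  proof (cases "x \<in> free (Bin b F1 F2)")
    case True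
    have "0 < size (components b F1)" "0 < size (components b F2)"
      by (simp_all add: nonempty_has_size[symmetric])
    then have "disconnected b (Bin b F1 F2)"
      by (simp add: disconnected_def)
    moreover have "dual (conn q) = b"
      using that by (simp add: dual_eq_iff)
    ultimately show ?thesis
      using that True by (auto simp: splittable_def)
  qed simp
  from assms(1) show ?thesis
  proof cases
    case (Sdown_Exists x F1 F2)
    then show ?thesis
      by (simp only:) (rule *, simp)
  next
    case (Sdown_Forall x F1 F2)
    then show ?thesis
      by (simp only:) (rule *, simp)
  next
    case (M x q)
    then show ?thesis
      by simp
  qed (use assms(2) in simp_all)
qed

lemma bad_rewrite_step: "rewrite_step {Rule_Sdown, Rule_M} F G \<Longrightarrow> bad F"
  by (induction rule: rewrite_step.induct) (auto intro: bad_root_step)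

section \<open>Formulas irreducible modulo ACO are not bad\<close>

definition irreducible :: "'r fo \<Rightarrow> bool" where
  "irreducible F \<longleftrightarrow> (\<nexists>F' G. (rewrite_step rules_ACO)\<^sup>*\<^sup>* F F'
     \<and> rewrite_step {Rule_Pdown, Rule_Sdown, Rule_M} F' G)"

lemma rewrite_context:
  assumes "(rewrite_step \<R>)\<^sup>*\<^sup>* F F'"
  shows "(rewrite_step \<R>)\<^sup>*\<^sup>* (Neg F) (Neg F')"
    "(rewrite_step \<R>)\<^sup>*\<^sup>* (Bin b F H) (Bin b F' H)"
    "(rewrite_step \<R>)\<^sup>*\<^sup>* (Bin b H F) (Bin b H F')"
    "(rewrite_step \<R>)\<^sup>*\<^sup>* (Qu q x F) (Qu q x F')"
  using assms
  by (induction rule: rtranclp_induct) (auto intro: rewrite_step.intros rtranclp.rtrancl_into_rtrancl)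

text \<open>A reduction of a subformula lifts to the whole formula. This lets the inductions below
  work with single formulas instead of classes.\<close>

lemma irreducible_subformula:
  "irreducible (Neg F) \<Longrightarrow> irreducible F"
  "irreducible (Bin b F G) \<Longrightarrow> irreducible F"
  "irreducible (Bin b F G) \<Longrightarrow> irreducible G"
  "irreducible (Qu q x F) \<Longrightarrow> irreducible F"
  unfolding irreducible_def by (meson rewrite_context rewrite_step.intros)+

lemma irreducible_ACO:
  "irreducible F \<Longrightarrow> (rewrite_step rules_ACO)\<^sup>*\<^sup>* F F' \<Longrightarrow> irreducible F'"
  unfolding irreducible_def by (meson rtranclp_trans)

lemma irreducible_root_step:
  assumes "irreducible F" "(rewrite_step rules_ACO)\<^sup>*\<^sup>* F F'"
    "R \<in> {Rule_Pdown, Rule_Sdown, Rule_M}"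
  shows "\<not> root_step R F' G"
  using assms unfolding irreducible_def by (meson at_root)

text \<open>An operand without \<open>x\<close> could be released from the scope of the quantifier
  by \<open>Rule_Pdown\<close>.\<close>

lemma irreducible_P:
  assumes "irreducible (Qu q x F)" "(rewrite_step rules_ACO)\<^sup>*\<^sup>* F (Bin (conn q) G H)"
  shows "x \<in> free H"
proof (rule ccontr)
  assume "x \<notin> free H"
  then have "root_step Rule_Pdown (Qu q x (Bin (conn q) G H)) (Bin (conn q) (Qu q x G) H)"
    by (auto simp: root_step_Pdown_iff)
  then show False
    using irreducible_root_step[OF assms(1) rewrite_context(4)[OF assms(2)], of Rule_Pdown] by blast
qed

lemma ACO_root:
  "(rewrite_step rules_ACO)\<^sup>*\<^sup>* (Bin b F G) (Bin b G F)"
  "(rewrite_step rules_ACO)\<^sup>*\<^sup>* (Bin b F (Bin b G H)) (Bin b (Bin b F G) H)"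
  "(rewrite_step rules_ACO)\<^sup>*\<^sup>* (Qu q x (Qu q y F)) (Qu q y (Qu q x F))"
  by (intro r_into_rtranclp at_root[of Rule_A] at_root[of Rule_C] at_root[of Rule_O] root_step.intros,
      simp add: rules_ACO_def)+

text \<open>In a block with several components, associativity and commutativity can isolate any of
  them as the right operand. A quantifier at the root leaves just one component: by
  \<open>irreducible_P\<close> its variable lies in every component of a body that has several, so
  they all merge.\<close>

lemma component_splits_off:
  assumes "irreducible F" "S \<in># components b F"
  shows "components b F = {#free F#} \<or>
     (\<exists>G H. (rewrite_step rules_ACO)\<^sup>*\<^sup>* F (Bin b G H) \<and> free H = S) \<and> (\<exists>G H. F = Bin b G H)"
  using assms
proof (induction F arbitrary: S)
  case (Bin c F G)
  show ?case
  proof (cases "c = b")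
    case True
    \<comment> \<open>The induction hypothesis is a premise here, so that after one use of
      commutativity the claim also covers the right operand.\<close>
    have left: "\<exists>K H. (rewrite_step rules_ACO)\<^sup>*\<^sup>* (Bin b F G) (Bin b K H) \<and> free H = S"
      if "irreducible F" "S \<in># components b F"
        "\<And>S. irreducible F \<Longrightarrow> S \<in># components b F \<Longrightarrow> components b F = {#free F#} \<or>
          (\<exists>G H. (rewrite_step rules_ACO)\<^sup>*\<^sup>* F (Bin b G H) \<and> free H = S) \<and> (\<exists>G H. F = Bin b G H)"
      for F G :: "'r fo"
      using that(3)[OF that(1,2)]
    proof (elim disjE conjE exE)
      assume "components b F = {#free F#}"
      then show ?thesis
        using that(2) ACO_root(1)[of b F G] by auto
    next
      fix K H
      assume "(rewrite_step rules_ACO)\<^sup>*\<^sup>* F (Bin b K H)" "free H = S"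
      then have "(rewrite_step rules_ACO)\<^sup>*\<^sup>* (Bin b F G) (Bin b (Bin b K H) G)"
        by (intro rewrite_context)
      also have "(rewrite_step rules_ACO)\<^sup>*\<^sup>* \<dots> (Bin b G (Bin b K H))"
        by (rule ACO_root)
      also have "(rewrite_step rules_ACO)\<^sup>*\<^sup>* \<dots> (Bin b (Bin b G K) H)"
        by (rule ACO_root)
      finally show ?thesis
        using \<open>free H = S\<close> by blast
    qed
    have irr: "irreducible F" "irreducible G"
      using Bin.prems(1) irreducible_subformula by blast+
    have "S \<in># components b F \<or> S \<in># components b G"
      using Bin.prems(2) True by auto
    then have "\<exists>K H. (rewrite_step rules_ACO)\<^sup>*\<^sup>* (Bin b F G) (Bin b K H) \<and> free H = S"
      using left[OF irr(1) _ Bin.IH(1), of G] left[OF irr(2) _ Bin.IH(2), of F] ACO_root(1)[of b F G]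
      by (meson rtranclp_trans)
    then show ?thesis
      using True by blast
  qed simp
next
  case (Qu q x F)
  show ?case
  proof (cases "conn q = b")
    case True
    have irr: "irreducible F"
      using Qu.prems(1) irreducible_subformula by blast
    have "x \<in> S" if "S \<in># components b F" "components b F \<noteq> {#free F#}" for S
      using Qu.IH[OF irr that(1)] that(2) irreducible_P[OF Qu.prems(1)] True by auto
    then consider "components b F = {#free F#}" | "\<forall>S\<in>#components b F. x \<in> S"
      by blast
    then have "\<exists>U. merge x (components b F) = {#U#}"
    proof cases
      case 2
      then have "{#S \<in># components b F. x \<notin> S#} = {#}"
        by simp
      with 2 show ?thesis
        by (auto simp: merge_def)
    qed (auto simp: merge_def)
    then have "\<exists>U. components b (Qu q x F) = {#U#}"
      using True by simp
    \<comment> \<open>The union of all components is the set of free variables, which determines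
      \<open>U\<close>.\<close>
    then have "components b (Qu q x F) = {#free (Qu q x F)#}"
      using Union_components[of b "Qu q x F"] by auto
    then show ?thesis
      by blast
  qed simp
qed simp_all

lemma irreducible_disconnected:
  assumes "irreducible F" "disconnected b F"
  shows "\<exists>G H. F = Bin b G H"
proof -
  obtain S where "S \<in># components b F"
    using components_nonempty by blast
  then show ?thesis
    using component_splits_off[OF assms(1)] assms(2) by (fastforce simp: disconnected_def)
qed

text \<open>Induction on the scope of the quantifier. Below the connective of the block both
  operands contain \<open>x\<close>, hence at least two leaves do; below the dual connective
  \<open>Rule_Sdown\<close> would apply; a quantifier of the same kind is passed by rule O; one of
  the other kind is a leaf that \<open>irreducible_disconnected\<close> shows to be
  connected.\<close>

lemma irreducible_not_splittable:
  "irreducible (Qu q x F) \<Longrightarrow> \<not> splittable x (leaves (conn q) F)"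
proof (induction F)
  case (Bin c F G)
  show ?case
  proof (cases "c = conn q")
    case True
    have "x \<in> free F" "x \<in> free G"
      using irreducible_P[OF Bin.prems, of G F] irreducible_P[OF Bin.prems, of F G] True
        ACO_root(1)[of c F G]
      by simp_all
    then have "\<exists>p\<in>#leaves c F. x \<in> fst p" "\<exists>p\<in>#leaves c G. x \<in> fst p"
      using Union_leaves[of c F] Union_leaves[of c G] by blast+
    then have "{#p \<in># leaves c F. x \<in> fst p#} \<noteq> {#}" "{#p \<in># leaves c G. x \<in> fst p#} \<noteq> {#}"
      by auto
    then show ?thesis
      using True by (simp add: splittable_def union_is_single)
  next
    case False
    with Bin.prems have "\<not> root_step Rule_Sdown (Qu q x (Bin c F G)) (Bin c (Qu q x F) (Qu q x G))"
      by (intro irreducible_root_step) auto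
    then show ?thesis
      using False Sdown_Exists[of x F G] Sdown_Forall[of x F G] by (cases q; cases c) simp_all
  qed
next
  case (Qu p y F)
  show ?case
  proof (cases "conn p = conn q")
    case True
    then have [simp]: "p = q"
      by (cases p; cases q) auto
    \<comment> \<open>Swapping the quantifiers puts \<open>x\<close> directly above
      \<open>F\<close>, where the induction hypothesis applies.\<close>
    have "irreducible (Qu q y (Qu q x F))"
      using irreducible_ACO[OF Qu.prems] ACO_root(3)[of q x y F] by simp
    then have not_split: "\<not> splittable x (leaves (conn q) F)"
      by (rule Qu.IH[OF irreducible_subformula(4)])
    show ?thesis
    proof (cases "x = y")
      case True
      \<comment> \<open>The inner quantifier on the same variable has removed \<open>x\<close> from
        every leaf.\<close>
      then show ?thesis
        by (simp add: splittable_def filter_mset_image_mset)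
    next
      case False
      then have "splittable x (image_mset (map_prod (\<lambda>S. S - {y}) id) (leaves (conn q) F))
          \<longleftrightarrow> splittable x (leaves (conn q) F)"
        by (intro splittable_image) simp
      with not_split show ?thesis
        by simp
    qed
  next
    case False
    have "\<not> disconnected (dual (conn q)) (Qu p y F)"
      using irreducible_disconnected[OF irreducible_subformula(4)[OF Qu.prems]] by blast
    then show ?thesis
      using False by (auto simp: splittable_def)
  qed
qed (auto simp: splittable_def)

lemma irreducible_not_bad: "irreducible F \<Longrightarrow> \<not> bad F"
proof (induction F)
  case (Qu q x F)
  have "\<not> root_step Rule_M (Qu q x F) F"
    using irreducible_root_step[OF Qu.prems] by blast
  then have "x \<in> free F"
    using root_step.M[of x F q] by blast
  then show ?case
    using Qu.IH[OF irreducible_subformula(4)[OF Qu.prems]] irreducible_not_splittable[OF Qu.prems]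
    by simp
next
  case (Neg F)
  then show ?case
    using irreducible_subformula(1)[of F] by simp
next
  case (Bin b F G)
  then show ?case
    using irreducible_subformula(2,3)[of b F G] by simp
qed simp

section \<open>Transfer to the quotient systems\<close>

lemma PFO_replace_free: "replace_free x y F \<in> PFO ar \<longleftrightarrow> F \<in> PFO ar"
  by (induction F) (auto simp: PFO_def)

lemma PFO_root_step: "root_step R F G \<Longrightarrow> F \<in> PFO ar \<longleftrightarrow> G \<in> PFO ar"
proof (induction rule: root_step.induct)
  case (N y F x q)
  then show ?case
    using PFO_replace_free[of x y F ar] by (simp add: PFO_def)
qed (auto simp: PFO_def)

lemma PFO_rewrite_step: "rewrite_step \<R> F G \<Longrightarrow> F \<in> PFO ar \<longleftrightarrow> G \<in> PFO ar"
proof (induction rule: rewrite_step.induct)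
  case (at_root R F G)
  then show ?case
    using PFO_root_step by blast
qed (auto simp: PFO_def)

text \<open>A reduction from a formula reached by ACO steps is a step between classes, once its two
  ends are known to be pfo-formulas.\<close>

lemma normal_form_irreducible:
  assumes "\<phi> \<in> PFO ar" "normal_form (system_Y ar) (conv_class ar rules_ACO \<phi>)"
  shows "irreducible \<phi>"
  unfolding irreducible_def
proof (intro notI, elim exE conjE)
  fix F G
  assume F: "(rewrite_step rules_ACO)\<^sup>*\<^sup>* \<phi> F"
    and G: "rewrite_step {Rule_Pdown, Rule_Sdown, Rule_M} F G"
  have "F \<in> PFO ar"
    using F
  proof (induction rule: rtranclp_induct)
    case (step G H)
    then show ?case
      using PFO_rewrite_step by blast
  qed (rule assms(1))
  moreover have "equivclp (rewrite_step rules_ACO) \<phi> F"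
    using F by (rule predicate2D[OF rtranlcp_le_equivclp])
  ultimately have F_class: "F \<in> conv_class ar rules_ACO \<phi>"
    using assms(1) by (simp add: conv_class_def convertible_def)
  have "G \<in> PFO ar"
    using PFO_rewrite_step[OF G] \<open>F \<in> PFO ar\<close> by blast
  then have G_class: "conv_class ar rules_ACO G \<in> PFO ar // convertible ar rules_ACO"
    "G \<in> conv_class ar rules_ACO G"
    by (auto simp: conv_class_def quotient_def convertible_def)
  have "snd (system_Y ar) (conv_class ar rules_ACO \<phi>) (conv_class ar rules_ACO G)"
    using F_class G_class(2) G by (auto simp: system_Y_def quotient_system_def)
  moreover have "conv_class ar rules_ACO G \<in> fst (system_Y ar)"
    using G_class(1) by (simp add: system_Y_def quotient_system_def)
  ultimately show False
    using assms(2) by (auto simp: normal_form_def)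
qed

theorem theorem4p3:
  fixes ar :: "'r \<Rightarrow> nat" and \<phi> :: "'r fo"
  assumes "\<phi> \<in> PFO ar"
    and "normal_form (system_Y ar) (conv_class ar rules_ACO \<phi>)"
  shows "normal_form (system_Y' ar) (conv_class ar rules_T \<phi>)"
proof -
  have "\<not> bad \<phi>"
    using assms by (intro irreducible_not_bad normal_form_irreducible)
  \<comment> \<open>Badness is constant on the class, whereas a step could only start from a bad
    member.\<close>
  then have "\<not> rewrite_step {Rule_Sdown, Rule_M} F G" if "F \<in> conv_class ar rules_T \<phi>" for F G
    using that bad_convertible bad_rewrite_step by (auto simp: conv_class_def convertible_def)
  moreover have "conv_class ar rules_T \<phi> \<in> PFO ar // convertible ar rules_T"
    using assms(1) by (auto simp: conv_class_def quotient_def)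
  ultimately show ?thesis
    by (auto simp: normal_form_def system_Y'_def quotient_system_def)
qed

end
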